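(* Consider a monotone-separable network under the stationary ergodic assumptions of the context and satisfying condition (AA) (see the context). Then, almost surely, $$Z_{(-\infty,0]}\ge\underline R=\max_{j=1,\ldots,r}\ \sup_{n\le0}\Bigl(\sum_{i=n}^0Y_i^{(j)}-\sum_{i=n}^{-1}\tau_i\Bigr).$$
   Context: Empty sums are $0$. Monotone-separable network. The input $N=\{T_n\}_{n\in\mathbb{Z}}$ is a nondecreasing real sequence of arrival epochs, $\tau_n=T_{n+1}-T_n$, and $\{\zeta_n\}_{n\in\mathbb{Z}}$ is a sequence with values in a measurable space $K$ (service times and routing decisions). There are measurable functions $f_l:\mathbb{R}^l\times K^l\to\mathbb{R}$, $l\ge1$, and for $m\le n$ one puts $X_{[m,n]}(N)=f_{n-m+1}\{(T_l,\zeta_l),\,m\le l\le n\}$ (the finite time of last activity when the network starts empty and is fed by $T_m,\ldots,T_n$). For all inputs $N$ and all $m\le n$ it is required that: (causality) $X_{[m,n]}(N)\ge T_n$; (external monotonicity) $X_{[m,n]}(N')\ge X_{[m,n]}(N)$ whenever $T'_k\ge T_k$ for all $k$; (homogeneity) $X_{[m,n]}(c+N)=X_{[m,n]}(N)+c$ for all $c\in\mathbb{R}$; (separability) for $m\le l<n$, if $X_{[m,l]}(N)\le T_{l+1}$ then $X_{[m,n]}(N)=X_{[l+1,n]}(N)$. Maximal daters: $Z_{[m,n]}(N)=X_{[m,n]}(N)-T_n$; $Z_n=Z_{[n,n]}(N)$ (which does not depend on $N$). The sequence $Z_{[-n,0]}(N)$ is nondecreasing in $n$, and $Z_{(-\infty,0]}=\lim_{n\to\infty}Z_{[-n,0]}(N)$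 is the stationary maximal dater. Stochastic assumptions: $\{(\tau_n,\zeta_n)\}$ is stationary and ergodic, $\mathbf{E}\tau_n=a=\lambda^{-1}<\infty$, $\mathbf{E}Z_n<\infty$. With $Q$ the degenerate input with all points equal to $0$, $\gamma(0)=\lim_n Z_{[-n,-1]}(Q)/n$ a.s.; the network is assumed stable: $\gamma(0)<a$. (AA): for all $i$, $Z_i=Y_i^{(1)}+\cdots+Y_i^{(r)}$, where the $Y_i^{(j)}$ are nonnegative, independent of the interarrival times, and the vectors $(Y_i^{(1)},\ldots,Y_i^{(r)})$ are i.i.d. in $i$ (with arbitrary dependence between the components of a vector); in addition, for all $n\le 0$, $Z_{[n,0]}(Q)\ge\max_{j}\sum_{i=n}^0Y_i^{(j)}$ a.s. *)

theory Defs
  imports "HOL-Probability.Probability"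
begin

text \<open>
  The network is given by functions \<open>f l\<close>, for \<open>l \<ge> 1\<close>, of \<open>l\<close> marked points. Such an
  \<open>l\<close>-tuple is an extensional function on \<open>{..<l}\<close>, so \<open>net_X\<close> only sees the epochs
  \<open>T\<close> and marks \<open>z\<close> with indices in \<open>{m..n}\<close>. The functions below are meant for \<open>m \<le> n\<close>.
\<close>

type_synonym 'k network = "nat \<Rightarrow> (nat \<Rightarrow> real \<times> 'k) \<Rightarrow> real"

definition measurable_network :: "'k measure \<Rightarrow> 'k network \<Rightarrow> bool" where
  "measurable_network K f \<longleftrightarrow>
     (\<forall>l\<ge>1. f l \<in> borel_measurable (PiM {..<l} (\<lambda>_. borel \<Otimes>\<^sub>M K)))"

definition net_X :: "'k network \<Rightarrow> (int \<Rightarrow> real) \<Rightarrow> (int \<Rightarrow> 'k) \<Rightarrow> int \<Rightarrow> int \<Rightarrow> real" where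
  "net_X f T z m n =
     (let l = nat (n - m + 1) in f l (\<lambda>i\<in>{..<l}. (T (m + int i), z (m + int i))))"

definition monotone_separable :: "'k network \<Rightarrow> (int \<Rightarrow> 'k) \<Rightarrow> bool" where
  "monotone_separable f z \<longleftrightarrow>
     (\<forall>T m n. mono T \<and> m \<le> n \<longrightarrow> T n \<le> net_X f T z m n) \<and>
     (\<forall>T T' m n. mono T \<and> mono T' \<and> m \<le> n \<and> (\<forall>k. T k \<le> T' k)
        \<longrightarrow> net_X f T z m n \<le> net_X f T' z m n) \<and>
     (\<forall>T c m n. mono T \<and> m \<le> n \<longrightarrow> net_X f (\<lambda>k. c + T k) z m n = net_X f T z m n + c) \<and>
     (\<forall>T m l n. mono T \<and> m \<le> l \<and> l < n \<and> net_X f T z m l \<le> T (l + 1)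
        \<longrightarrow> net_X f T z m n = net_X f T z (l + 1) n)"

definition net_Z :: "'k network \<Rightarrow> (int \<Rightarrow> real) \<Rightarrow> (int \<Rightarrow> 'k) \<Rightarrow> int \<Rightarrow> int \<Rightarrow> real" where
  "net_Z f T z m n = net_X f T z m n - T n"

definition degenerate_input :: "int \<Rightarrow> real" where
  "degenerate_input = (\<lambda>_. 0)"

definition stationary_maximal_dater ::
    "'k network \<Rightarrow> (int \<Rightarrow> real) \<Rightarrow> (int \<Rightarrow> 'k) \<Rightarrow> ereal" where
  "stationary_maximal_dater f T z = lim (\<lambda>n. ereal (net_Z f T z (- int n) 0))"

definition interarrival :: "(int \<Rightarrow> 'w \<Rightarrow> real) \<Rightarrow> int \<Rightarrow> 'w \<Rightarrow> real" where
  "interarrival T n \<omega> = T (n + 1) \<omega> - T n \<omega>"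

definition path_law :: "'w measure \<Rightarrow> 's measure \<Rightarrow> (int \<Rightarrow> 'w \<Rightarrow> 's) \<Rightarrow> (int \<Rightarrow> 's) measure" where
  "path_law M S U = distr M (PiM UNIV (\<lambda>_. S)) (\<lambda>\<omega> n. U n \<omega>)"

definition shift :: "(int \<Rightarrow> 's) \<Rightarrow> int \<Rightarrow> 's" where
  "shift x = (\<lambda>n. x (n + 1))"

definition stationary_ergodic :: "'w measure \<Rightarrow> 's measure \<Rightarrow> (int \<Rightarrow> 'w \<Rightarrow> 's) \<Rightarrow> bool" where
  "stationary_ergodic M S U \<longleftrightarrow>
     (\<forall>n. U n \<in> measurable M S) \<and>
     distr (path_law M S U) (PiM UNIV (\<lambda>_. S)) shift = path_law M S U \<and>
     (\<forall>A \<in> sets (path_law M S U). shift -` A \<inter> space (path_law M S U) = A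
        \<longrightarrow> measure (path_law M S U) A \<in> {0, 1})"

text \<open>
  The library's \<open>indep_var\<close> needs both variables to have the same type, hence the
  formulation through the generated sigma-algebras.
\<close>

definition indep_rvs ::
    "'w measure \<Rightarrow> 'a measure \<Rightarrow> ('w \<Rightarrow> 'a) \<Rightarrow> 'b measure \<Rightarrow> ('w \<Rightarrow> 'b) \<Rightarrow> bool" where
  "indep_rvs M A X B Y \<longleftrightarrow>
     X \<in> measurable M A \<and> Y \<in> measurable M B \<and>
     prob_space.indep_set M (sets (vimage_algebra (space M) X A))
       (sets (vimage_algebra (space M) Y B))"

definition component_vector :: "nat \<Rightarrow> (nat \<Rightarrow> int \<Rightarrow> 'w \<Rightarrow> real) \<Rightarrow> int \<Rightarrow> 'w \<Rightarrow> nat \<Rightarrow> real" where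
  "component_vector r Y i \<omega> = (\<lambda>j\<in>{1..r}. Y j i \<omega>)"

definition condition_AA ::
    "'w measure \<Rightarrow> 'k network \<Rightarrow> (int \<Rightarrow> 'w \<Rightarrow> real) \<Rightarrow> (int \<Rightarrow> 'w \<Rightarrow> 'k) \<Rightarrow>
     nat \<Rightarrow> (nat \<Rightarrow> int \<Rightarrow> 'w \<Rightarrow> real) \<Rightarrow> bool" where
  "condition_AA M f T \<zeta> r Y \<longleftrightarrow>
     (let V = PiM {1..r} (\<lambda>_. borel :: real measure) in
     (\<forall>i. AE \<omega> in M. net_Z f (\<lambda>k. T k \<omega>) (\<lambda>k. \<zeta> k \<omega>) i i = (\<Sum>j=1..r. Y j i \<omega>)) \<and>
     (\<forall>j\<in>{1..r}. \<forall>i. AE \<omega> in M. 0 \<le> Y j i \<omega>) \<and>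
     indep_rvs M (PiM UNIV (\<lambda>_. V)) (\<lambda>\<omega> i. component_vector r Y i \<omega>)
       (PiM UNIV (\<lambda>_. borel)) (\<lambda>\<omega> n. interarrival T n \<omega>) \<and>
     prob_space.indep_vars M (\<lambda>_. V) (component_vector r Y) UNIV \<and>
     (\<forall>i i'. distr M V (component_vector r Y i) = distr M V (component_vector r Y i')) \<and>
     (\<forall>n\<le>0. AE \<omega> in M. net_Z f degenerate_input (\<lambda>k. \<zeta> k \<omega>) n 0
        \<ge> (MAX j\<in>{1..r}. \<Sum>i=n..0. Y j i \<omega>)))"

definition R_lower ::
    "(int \<Rightarrow> 'w \<Rightarrow> real) \<Rightarrow> nat \<Rightarrow> (nat \<Rightarrow> int \<Rightarrow> 'w \<Rightarrow> real) \<Rightarrow> 'w \<Rightarrow> ereal" where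
  "R_lower T r Y \<omega> =
     (MAX j\<in>{1..r}. SUP n\<in>{..0}. ereal ((\<Sum>i=n..0. Y j i \<omega>) - (\<Sum>i=n..-1. interarrival T i \<omega>)))"

end

theory Submission
  imports Defs
begin

text \<open>
  Replacing the epochs by the constant input at \<open>T\<^sub>n\<close> can only decrease \<open>X\<^bsub>[n,0]\<^esub>\<close>, so
  external monotonicity and homogeneity give
  \<open>Z\<^bsub>[n,0]\<^esub>(N) \<ge> Z\<^bsub>[n,0]\<^esub>(Q) - (T\<^sub>0 - T\<^sub>n)\<close>, and condition (AA) bounds \<open>Z\<^bsub>[n,0]\<^esub>(Q)\<close> from below.
  The limit defining the stationary maximal dater is a supremum because \<open>X\<^bsub>[m,n]\<^esub>\<close> decreases
  when its first point is dropped: moving the points up to \<open>m\<close> far enough to the left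
  decreases \<open>X\<^bsub>[m,n]\<^esub>\<close>, and by separability then makes it equal to \<open>X\<^bsub>[m+1,n]\<^esub>\<close>.
\<close>

lemma net_X_cong:
  assumes "\<And>k. m \<le> k \<Longrightarrow> k \<le> n \<Longrightarrow> T k = T' k"
  shows "net_X f T z m n = net_X f T' z m n"
proof -
  have "(\<lambda>i\<in>{..<nat (n - m + 1)}. (T (m + int i), z (m + int i))) =
        (\<lambda>i\<in>{..<nat (n - m + 1)}. (T' (m + int i), z (m + int i)))"
    by (rule restrict_ext) (auto intro!: assms)
  then show ?thesis
    by (simp add: net_X_def Let_def)
qed

context
  fixes f :: "'k network" and z :: "int \<Rightarrow> 'k" and T :: "int \<Rightarrow> real"
  assumes net: "monotone_separable f z" and mono_T: "mono T"
begin

lemma net_X_external_mono: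
  assumes "mono T'" "m \<le> n" "\<And>k. T' k \<le> T k"
  shows "net_X f T' z m n \<le> net_X f T z m n"
  using net mono_T assms unfolding monotone_separable_def by blast

lemma net_X_drop_first:
  assumes "m < n"
  shows "net_X f T z (m + 1) n \<le> net_X f T z m n"
proof -
  \<comment> \<open>By causality, \<open>c\<close> is a nonnegative delay. Moving the points up to
    \<open>m\<close> left by \<open>c\<close> keeps the input nondecreasing and below
    \<open>T\<close>, and the activity due to point \<open>m\<close> alone then ends at
    \<open>T m\<close>, which is at most \<open>T (m + 1)\<close>.\<close>
  define c where "c = net_X f T z m m - T m"
  have c: "c \<ge> 0"
    using net mono_T unfolding monotone_separable_def c_def by fastforce
  define T' where "T' k = (if k \<le> m then T k - c else T k)" for k
  have mono': "mono T'"
  proof (rule monoI)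
    fix x y :: int assume "x \<le> y"
    then show "T' x \<le> T' y"
      using monoD[OF mono_T \<open>x \<le> y\<close>] c by (auto simp: T'_def)
  qed
  \<comment> \<open>Only the epoch at \<open>m\<close> counts here, so \<open>T'\<close> may be
    exchanged for a global shift of \<open>T\<close>, to which homogeneity applies.\<close>
  have "net_X f T' z m m = net_X f (\<lambda>k. - c + T k) z m m"
    by (rule net_X_cong) (simp add: T'_def)
  also have "\<dots> = net_X f T z m m + - c"
    using net mono_T unfolding monotone_separable_def by blast
  also have "\<dots> = T m"
    by (simp add: c_def)
  also have "\<dots> \<le> T' (m + 1)"
    using monoD[OF mono_T, of m "m + 1"] by (simp add: T'_def)
  finally have "net_X f T' z m n = net_X f T' z (m + 1) n"
    using net mono' assms unfolding monotone_separable_def by blast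
  also have "\<dots> = net_X f T z (m + 1) n"
    by (rule net_X_cong) (simp add: T'_def)
  finally have "net_X f T z (m + 1) n = net_X f T' z m n" ..
  also have "\<dots> \<le> net_X f T z m n"
    using c assms by (intro net_X_external_mono mono') (auto simp: T'_def)
  finally show ?thesis .
qed

lemma incseq_net_Z: "incseq (\<lambda>n. net_Z f T z (- int n) 0)"
proof (rule incseq_SucI)
  fix n
  show "net_Z f T z (- int n) 0 \<le> net_Z f T z (- int (Suc n)) 0"
    using net_X_drop_first[of "- int (Suc n)" 0] by (simp add: net_Z_def)
qed

lemma net_Z_le_stationary_maximal_dater:
  assumes "m \<le> 0"
  shows "ereal (net_Z f T z m 0) \<le> stationary_maximal_dater f T z"
proof -
  have inc: "incseq (\<lambda>n. ereal (net_Z f T z (- int n) 0))"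
    using incseq_net_Z by (simp add: incseq_def)
  \<comment> \<open>In \<open>ereal\<close> an increasing sequence always converges, so
    \<open>lim\<close> is a genuine limit, possibly infinite.\<close>
  have "stationary_maximal_dater f T z = (SUP n. ereal (net_Z f T z (- int n) 0))"
    unfolding stationary_maximal_dater_def by (rule limI[OF LIMSEQ_SUP[OF inc]])
  moreover have "ereal (net_Z f T z (- int (nat (- m))) 0) \<le> (SUP n. ereal (net_Z f T z (- int n) 0))"
    by (rule SUP_upper) simp
  ultimately show ?thesis
    using assms by simp
qed

lemma net_Z_ge_degenerate_input:
  assumes "m \<le> n"
  shows "net_Z f degenerate_input z m n - (T n - T m) \<le> net_Z f T z m n"
proof -
  \<comment> \<open>External monotonicity compares inputs at all indices. The minimum keeps
    \<open>T'\<close> below \<open>T\<close> before \<open>m\<close> as well, while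
    \<open>T'\<close> is constantly \<open>T m\<close> from \<open>m\<close> on.\<close>
  define T' where "T' k = min (T m) (T k)" for k
  have mono': "mono T'"
    using mono_T unfolding T'_def mono_def by (meson min.mono order_refl)
  have Q: "mono degenerate_input"
    by (simp add: degenerate_input_def mono_def)
  have "net_X f T' z m n = net_X f (\<lambda>k. T m + degenerate_input k) z m n"
    using monoD[OF mono_T] by (intro net_X_cong) (auto simp: T'_def degenerate_input_def min_def)
  also have "\<dots> = net_X f degenerate_input z m n + T m"
    using net Q assms unfolding monotone_separable_def by blast
  finally have "net_X f degenerate_input z m n + T m \<le> net_X f T z m n"
    using net_X_external_mono[OF mono' assms] by (simp add: T'_def)
  then show ?thesis
    by (simp add: net_Z_def degenerate_input_def)
qed

end

text \<open>Telescoping; this turns the loss \<open>T 0 - T n\<close> from the comparison with the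
  degenerate input into the sum subtracted in \<open>R_lower\<close>.\<close>

lemma sum_interarrival:
  assumes "n \<le> 0"
  shows "(\<Sum>i=n..-1. interarrival T i \<omega>) = T 0 \<omega> - T n \<omega>"
  using assms
proof (induction n rule: int_le_induct)
  case base
  then show ?case by simp
next
  case (step i)
  have "{i - 1..-1} = insert (i - 1) {i..-1}"
    using step.hyps by auto
  then show ?case
    using step.IH by (simp add: interarrival_def)
qed

theorem lemma6:
  fixes M :: "'w measure" and K :: "'k measure"
    and f :: "'k network"
    and T :: "int \<Rightarrow> 'w \<Rightarrow> real" and \<zeta> :: "int \<Rightarrow> 'w \<Rightarrow> 'k"
    and a \<gamma>\<^sub>0 :: real
    and r :: nat and Y :: "nat \<Rightarrow> int \<Rightarrow> 'w \<Rightarrow> real"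
  assumes "prob_space M"
    and "\<And>n. T n \<in> borel_measurable M"
    and "\<And>n. \<zeta> n \<in> measurable M K"
    and "\<And>\<omega>. \<omega> \<in> space M \<Longrightarrow> mono (\<lambda>n. T n \<omega>)"
    and "measurable_network K f"
    and "\<And>\<omega>. \<omega> \<in> space M \<Longrightarrow> monotone_separable f (\<lambda>n. \<zeta> n \<omega>)"
    and "stationary_ergodic M (borel \<Otimes>\<^sub>M K) (\<lambda>n \<omega>. (interarrival T n \<omega>, \<zeta> n \<omega>))"
    and "\<And>n. integrable M (interarrival T n)"
    and "\<And>n. prob_space.expectation M (interarrival T n) = a"
    and "\<And>n. integrable M (\<lambda>\<omega>. net_Z f (\<lambda>k. T k \<omega>) (\<lambda>k. \<zeta> k \<omega>) n n)"
    and "AE \<omega> in M. (\<lambda>n. net_Z f degenerate_input (\<lambda>k. \<zeta> k \<omega>) (- int n) (-1) / real n)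
           \<longlonglongrightarrow> \<gamma>\<^sub>0"
    and "\<gamma>\<^sub>0 < a"
    and "r \<ge> 1"
    and "condition_AA M f T \<zeta> r Y"
  shows "AE \<omega> in M. stationary_maximal_dater f (\<lambda>k. T k \<omega>) (\<lambda>k. \<zeta> k \<omega>) \<ge> R_lower T r Y \<omega>"
proof -
  \<comment> \<open>The exceptional null set in (AA) may depend on \<open>n\<close>; countably many
    \<open>n\<close> leave one common null set, outside which the argument is pathwise.\<close>
  have "AE \<omega> in M. \<forall>n\<in>{..0}.
      (MAX j\<in>{1..r}. \<Sum>i=n..0. Y j i \<omega>) \<le> net_Z f degenerate_input (\<lambda>k. \<zeta> k \<omega>) n 0"
    using assms(14) by (intro AE_ball_countable') (auto simp: condition_AA_def Let_def)
  then show ?thesis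
  proof (rule AE_mp[OF _ AE_I2], intro impI)
    fix \<omega> assume \<omega>: "\<omega> \<in> space M"
      and Q: "\<forall>n\<in>{..0}. (MAX j\<in>{1..r}. \<Sum>i=n..0. Y j i \<omega>)
        \<le> net_Z f degenerate_input (\<lambda>k. \<zeta> k \<omega>) n 0"
    note net = assms(6)[OF \<omega>] assms(4)[OF \<omega>]
    let ?Z = "stationary_maximal_dater f (\<lambda>k. T k \<omega>) (\<lambda>k. \<zeta> k \<omega>)"
    have "ereal ((\<Sum>i=n..0. Y j i \<omega>) - (\<Sum>i=n..-1. interarrival T i \<omega>)) \<le> ?Z"
      if j: "j \<in> {1..r}" and n: "n \<le> 0" for j n
    proof -
      have "(\<Sum>i=n..0. Y j i \<omega>) \<le> (MAX j\<in>{1..r}. \<Sum>i=n..0. Y j i \<omega>)"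
        using j by (intro Max_ge) auto
      also have "\<dots> \<le> net_Z f degenerate_input (\<lambda>k. \<zeta> k \<omega>) n 0"
        using Q n by simp
      finally have "(\<Sum>i=n..0. Y j i \<omega>) - (\<Sum>i=n..-1. interarrival T i \<omega>)
          \<le> net_Z f (\<lambda>k. T k \<omega>) (\<lambda>k. \<zeta> k \<omega>) n 0"
        using net_Z_ge_degenerate_input[OF net n] by (simp add: sum_interarrival[OF n])
      then show ?thesis
        using net_Z_le_stationary_maximal_dater[OF net n] order_trans ereal_less_eq(3) by blast
    qed
    then show "R_lower T r Y \<omega> \<le> ?Z"
      \<comment> \<open>With \<open>r\<close> at least 1 the maximum ranges over a nonempty finite
        set, so bounding each supremum suffices.\<close>
      using \<open>r \<ge> 1\<close> unfolding R_lower_def by (auto intro!: Max.boundedI SUP_least)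
  qed
qed

end
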